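(* Let $(O,Q)$ be an HMM realization of order $k$ of the stationary process $\{y_t\}$ with deterministic observation $\phi$, let $\rho$ be the stationary distribution of the state, and let the tensor $M$, the matrices $A,B,C$ and the subspaces $V_R$, $V_{R,u}$ be as defined in the context (for a fixed integer $n\ge 1$). Assume $V_{R,u}\not\subset\ker e^{\mathrm T}$ for every $u=1,\ldots,d$, and suppose $\hat k_R=\dim V_R<k$. Let $T_R=(t_{R,ij})\in\mathbb{R}^{k\times\hat k_R}$ be a full-column-rank matrix and $\hat\phi_R:\{1,\ldots,\hat k_R\}\to\{1,\ldots,d\}$ a map such that (i) $t_{R,ij}=0$ if $\phi(i)\ne\hat\phi_R(j)$; (ii) $V_R=\operatorname{ran}T_R$; (iii) $e^{\mathrm T}T_R=\hat e_R^{\mathrm T}$, where $\hat e_R\in\mathbb{R}^{\hat k_R}$ is the all-ones vector. Define $\hat Q_R\in\mathbb{R}^{\hat k_R\times\hat k_R}$, $\hat O_R\in\mathbb{R}^{d\times\hat k_R}$ and $\hat\rho_R\in\mathbb{R}^{\hat k_R}$ by $QT_R=T_R\hat Q_R$, $\hat O_R=OT_R$ and $\rho=T_R\hat\rho_R$. Let $\hat I_{R,u}\in\mathbb{R}^{\hat k_R\times\hat k_R}$ be the diagonal matrix whose $(i,i)$th element is $1$ if $\hat\phi_R(i)=u$ and $0$ otherwise. Define $\hat A_R,\hat B_R\in\mathbb{R}^{d^n\times\hat k_R}$ and $\hat C_R\in\mathbb{R}^{d\times\hat k_R}$ by giving their $L(u_1^n)$th rows, for $u_1^n=(u_1,\ldots,u_n)\in\{1,\ldots,d\}^n$,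 $$\hat A_{R,L(u_1^n)}=\hat e_R^{\mathrm T}\hat I_{R,u_n}\hat Q_R\cdots\hat I_{R,u_1}\hat Q_R,\qquad \hat B_{R,L(u_1^n)}=\hat\rho_R^{\mathrm T}\hat I_{R,u_n}\hat Q_R^{\mathrm T}\cdots\hat I_{R,u_1}\hat Q_R^{\mathrm T},\qquad \hat C_R=\hat O_R .$$ Then $$M=A\otimes B\otimes C=\hat A_R\otimes\hat B_R\otimes\hat C_R .$$
   Context: Realization: $\{y_t\}_{t\in\mathbb{Z}}$ is a stationary process with values in $\{1,\ldots,d\}$. $\{x_t\}_{t\in\mathbb{Z}}$ is a stationary Markov chain on $\{1,\ldots,k\}$ with transition matrix $Q=(q_{ij})\in\mathbb{R}^{k\times k}$, $q_{ij}=\mathbb{P}(x_{t+1}=i\mid x_t=j)$ (so $Q$ is nonnegative and each column sums to one). $\phi:\{1,\ldots,k\}\to\{1,\ldots,d\}$ is a map, and $O=(o_{ij})\in\mathbb{R}^{d\times k}$ has $o_{ij}=1$ if $\phi(j)=i$ and $o_{ij}=0$ otherwise. "$(O,Q)$ is an HMM realization of order $k$ with deterministic observation $\phi$" means that $\{y_t\}$ and $\{\phi(x_t)\}$ have the same law. $e\in\mathbb{R}^k$ is the all-ones vector, so $e^{\mathrm T}Q=e^{\mathrm T}$; $\rho\in\mathbb{R}^k$ is the stationary distribution of $\{x_t\}$, $\rho_i=\mathbb{P}(x_t=i)$, so $Q\rho=\rho$. For $u=1,\ldots,d$, $I_u\in\mathbb{R}^{k\times k}$ is the diagonal matrix whose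 $(i,i)$th element is $1$ if $\phi(i)=u$ and $0$ otherwise. Reachable subspace: $V_R=\operatorname{span}\{I_{u_n}Q\cdots I_{u_1}QI_{u_0}\rho: (u_0,\ldots,u_n)\in\{1,\ldots,d\}^{n+1},\ n=0,1,2,\ldots\}$, and $V_{R,u}=I_uV_R$. (It is $Q$-invariant and contains $\rho$, so $\hat Q_R$ and $\hat\rho_R$ in the claim are well defined.) $\operatorname{ran}$ denotes the column space. Tensor: for $u_1^n=(u_1,\ldots,u_n)\in\{1,\ldots,d\}^n$ put $L(u_1^n)=(u_1-1)d^{n-1}+(u_2-1)d^{n-2}+\cdots+(u_{n-1}-1)d+u_n\in\{1,\ldots,d^n\}$. $M\in\mathbb{R}^{d^n\times d^n\times d}$ is the third-order tensor with entries $M_{L(u_1,\ldots,u_n),\,L(u_{-1},\ldots,u_{-n}),\,u_0}=\mathbb{P}\{y_t=u_t \text{ for all } t=-n,\ldots,n\}$. The matrices $A,B\in\mathbb{R}^{d^n\times k}$ and $C\in\mathbb{R}^{d\times k}$ are given by rows $A_{L(u_1^n)}=e^{\mathrm T}I_{u_n}Q\cdots I_{u_1}Q$, $B_{L(u_1^n)}=\rho^{\mathrm T}I_{u_n}Q^{\mathrm T}\cdots I_{u_1}Q^{\mathrm T}$, and $C=O$. For matrices $X,Y,Z$ with the same number $r$ of columns $x_i,y_i,z_i$, $X\otimes Y\otimes Z$ denotes the third-order tensor $\sum_{i=1}^r x_i\otimes y_i\otimes z_i$ (a sum of $r$ rank-one tensors). *)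

theory Defs
  imports
    "HOL-Probability.Probability"
    "Jordan_Normal_Form.DL_Rank"
    "Jordan_Normal_Form.Matrix_Kernel"
begin

unbundle no vec_syntax
unbundle no inner_syntax

text \<open>
  Convention: states and observation symbols are numbered from 0, i.e. the state
  space is \<open>{..<k}\<close>, the alphabet is \<open>{..<d}\<close> and words of length \<open>n\<close> are numbered by \<open>{..<d ^ n}\<close>,
  in accordance with the 0-based indices of matrices and vectors.
  Words \<open>(u\<^sub>1, \<dots>, u\<^sub>n)\<close> are lists with head \<open>u\<^sub>1\<close>.
\<close>


section \<open>Processes and realizations\<close>

definition process_law :: "'a measure \<Rightarrow> nat \<Rightarrow> (int \<Rightarrow> 'a \<Rightarrow> nat) \<Rightarrow> (int \<Rightarrow> nat) measure" where
  "process_law \<Omega> m z = distr \<Omega> (\<Pi>\<^sub>M t\<in>UNIV. count_space {..<m}) (\<lambda>\<omega> t. z t \<omega>)"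

definition stationary_process :: "'a measure \<Rightarrow> nat \<Rightarrow> (int \<Rightarrow> 'a \<Rightarrow> nat) \<Rightarrow> bool" where
  "stationary_process \<Omega> m z \<longleftrightarrow>
     prob_space \<Omega> \<and>
     (\<forall>t. z t \<in> measurable \<Omega> (count_space {..<m})) \<and>
     (\<forall>s. process_law \<Omega> m (\<lambda>t. z (t + s)) = process_law \<Omega> m z)"

text \<open>
  Column convention: \<open>Q $$ (i, j)\<close> is the probability of moving from \<open>j\<close> to \<open>i\<close>. Conditional
  probabilities are only constrained when the conditioning event has positive probability;
  the columns of \<open>Q\<close> belonging to null states are arbitrary probability vectors.
\<close>

definition stationary_markov_chain ::
    "'a measure \<Rightarrow> nat \<Rightarrow> (int \<Rightarrow> 'a \<Rightarrow> nat) \<Rightarrow> real mat \<Rightarrow> bool" where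
  "stationary_markov_chain \<Omega> k x Q \<longleftrightarrow>
     stationary_process \<Omega> k x \<and>
     Q \<in> carrier_mat k k \<and>
     (\<forall>j<k. (\<forall>i<k. 0 \<le> Q $$ (i, j)) \<and> (\<Sum>i<k. Q $$ (i, j)) = 1) \<and>
     (\<forall>t. \<forall>i<k. \<forall>j<k. \<P>(\<omega> in \<Omega>. x t \<omega> = j) > 0 \<longrightarrow>
        \<P>(\<omega> in \<Omega>. x (t + 1) \<omega> = i \<bar> x t \<omega> = j) = Q $$ (i, j)) \<and>
     (\<forall>t (m::nat) (s :: int \<Rightarrow> nat). \<forall>i<k.
        \<P>(\<omega> in \<Omega>. \<forall>r\<in>{t - int m..t}. x r \<omega> = s r) > 0 \<longrightarrow>
        \<P>(\<omega> in \<Omega>. x (t + 1) \<omega> = i \<bar> \<forall>r\<in>{t - int m..t}. x r \<omega> = s r) =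
        \<P>(\<omega> in \<Omega>. x (t + 1) \<omega> = i \<bar> x t \<omega> = s t))"

definition obs_mat :: "nat \<Rightarrow> nat \<Rightarrow> (nat \<Rightarrow> nat) \<Rightarrow> real mat" where
  "obs_mat d k \<phi> = mat d k (\<lambda>(i, j). if \<phi> j = i then 1 else 0)"

definition hmm_realization ::
    "'a measure \<Rightarrow> (int \<Rightarrow> 'a \<Rightarrow> nat) \<Rightarrow> 'b measure \<Rightarrow> (int \<Rightarrow> 'b \<Rightarrow> nat) \<Rightarrow>
     nat \<Rightarrow> nat \<Rightarrow> (nat \<Rightarrow> nat) \<Rightarrow> real mat \<Rightarrow> real mat \<Rightarrow> bool" where
  "hmm_realization \<Omega> y \<Omega>' x d k \<phi> Ob Q \<longleftrightarrow>
     stationary_process \<Omega> d y \<and>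
     stationary_markov_chain \<Omega>' k x Q \<and>
     \<phi> \<in> {..<k} \<rightarrow> {..<d} \<and>
     Ob = obs_mat d k \<phi> \<and>
     process_law \<Omega> d y = process_law \<Omega>' d (\<lambda>t \<omega>. \<phi> (x t \<omega>))"

text \<open>By stationarity, the choice of time 0 is immaterial.\<close>

definition state_distribution :: "'b measure \<Rightarrow> nat \<Rightarrow> (int \<Rightarrow> 'b \<Rightarrow> nat) \<Rightarrow> real vec" where
  "state_distribution \<Omega>' k x = vec k (\<lambda>i. \<P>(\<omega> in \<Omega>'. x 0 \<omega> = i))"


section \<open>Word products and the reachable subspace\<close>

definition ones :: "nat \<Rightarrow> real vec" where
  "ones k = vec k (\<lambda>_. 1)"

definition symbol_proj :: "nat \<Rightarrow> (nat \<Rightarrow> nat) \<Rightarrow> nat \<Rightarrow> real mat" where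
  "symbol_proj k \<phi> u = mat_diag k (\<lambda>i. if \<phi> i = u then 1 else 0)"

text \<open>\<open>word_prod k \<phi> Q [u\<^sub>1, \<dots>, u\<^sub>n]\<close> is the product \<open>I\<^bsub>u\<^sub>n\<^esub> Q \<dots> I\<^bsub>u\<^sub>1\<^esub> Q\<close>, with \<open>u\<^sub>1\<close> rightmost.\<close>

fun word_prod :: "nat \<Rightarrow> (nat \<Rightarrow> nat) \<Rightarrow> real mat \<Rightarrow> nat list \<Rightarrow> real mat" where
  "word_prod k \<phi> Q [] = 1\<^sub>m k"
| "word_prod k \<phi> Q (u # us) = word_prod k \<phi> Q us * (symbol_proj k \<phi> u * Q)"

definition reachable_subspace ::
    "nat \<Rightarrow> nat \<Rightarrow> (nat \<Rightarrow> nat) \<Rightarrow> real mat \<Rightarrow> real vec \<Rightarrow> real vec set" where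
  "reachable_subspace d k \<phi> Q \<rho> =
     LinearCombinations.module.span class_ring (module_vec TYPE(real) k)
       {word_prod k \<phi> Q us *\<^sub>v (symbol_proj k \<phi> u *\<^sub>v \<rho>) | u us. u < d \<and> set us \<subseteq> {..<d}}"

definition subspace_dim :: "nat \<Rightarrow> real vec set \<Rightarrow> nat" where
  "subspace_dim k V = vectorspace.dim class_ring ((module_vec TYPE(real) k)\<lparr>carrier := V\<rparr>)"


section \<open>Numbering of words, third-order tensors\<close>

definition words :: "nat \<Rightarrow> nat \<Rightarrow> nat list set" where
  "words d n = {us. length us = n \<and> set us \<subseteq> {..<d}}"

definition word_index :: "nat \<Rightarrow> nat list \<Rightarrow> nat" where
  "word_index d us = (\<Sum>i<length us. us ! i * d ^ (length us - 1 - i))"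

definition word_of_index :: "nat \<Rightarrow> nat \<Rightarrow> nat \<Rightarrow> nat list" where
  "word_of_index d n = inv_into (words d n) (word_index d)"

lemma word_index_Cons:
  "word_index d (u # us) = u * d ^ length us + word_index d us"
  unfolding word_index_def length_Cons by (subst sum.lessThan_Suc_shift) simp

lemma word_index_less:
  assumes "set us \<subseteq> {..<d}"
  shows "word_index d us < d ^ length us"
  using assms
proof (induction us)
  case Nil
  then show ?case by (simp add: word_index_def)
next
  case (Cons u us)
  then have "word_index d us < d ^ length us" and "Suc u \<le> d" by auto
  then have "word_index d (u # us) < Suc u * d ^ length us"
    by (simp add: word_index_Cons)
  also have "\<dots> \<le> d * d ^ length us"
    using \<open>Suc u \<le> d\<close> by (rule mult_le_mono1)
  finally show ?case by simp
qed

lemma word_index_eqD: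
  assumes "length us = length vs" "set us \<subseteq> {..<d}" "set vs \<subseteq> {..<d}"
    and "word_index d us = word_index d vs"
  shows "us = vs"
  using assms
proof (induction us vs rule: list_induct2)
  case Nil
  then show ?case by simp
next
  case (Cons u us v vs)
  have lt: "word_index d us < d ^ length us" "word_index d vs < d ^ length us"
    using Cons word_index_less[of us d] word_index_less[of vs d] by auto
  have pos: "d ^ length us \<noteq> 0"
    using lt by linarith
  have eq: "u * d ^ length us + word_index d us = v * d ^ length us + word_index d vs"
    using Cons by (simp add: word_index_Cons)
  have "u = (u * d ^ length us + word_index d us) div d ^ length us"
    using lt div_mult_self3[OF pos, of u] by simp
  also have "\<dots> = v"
    unfolding eq using lt div_mult_self3[OF pos, of v] by simp
  finally show ?case using eq Cons by simp
qed

lemma bij_betw_word_index: "bij_betw (word_index d) (words d n) {..<d ^ n}"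
proof -
  have inj: "inj_on (word_index d) (words d n)"
    by (rule inj_onI) (auto simp: words_def intro: word_index_eqD)
  have sub: "word_index d ` words d n \<subseteq> {..<d ^ n}"
    using word_index_less by (auto simp: words_def)
  have "card (words d n) = d ^ n"
    using card_lists_length_eq[of "{..<d}" n] by (simp add: words_def conj_commute)
  then have "word_index d ` words d n = {..<d ^ n}"
    using card_subset_eq[OF _ sub] card_image[OF inj] by simp
  with inj show ?thesis by (simp add: bij_betw_def)
qed

lemma word_of_index_word_index:
  "us \<in> words d n \<Longrightarrow> word_of_index d n (word_index d us) = us"
  unfolding word_of_index_def
  using bij_betw_word_index by (simp add: bij_betw_def inv_into_f_f)

text \<open>
  A tensor of size \<open>p \<times> q \<times> r\<close> is a function on index triples that is \<^const>\<open>undefined\<close>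
  outside the index box, so that equality of tensors is equality of all entries.
\<close>

type_synonym tensor3 = "nat \<times> nat \<times> nat \<Rightarrow> real"

definition outer3 :: "real vec \<Rightarrow> real vec \<Rightarrow> real vec \<Rightarrow> tensor3" where
  "outer3 x y z = (\<lambda>(a, b, c) \<in> {..<dim_vec x} \<times> {..<dim_vec y} \<times> {..<dim_vec z}.
     x $ a * y $ b * z $ c)"

definition cp_tensor :: "real mat \<Rightarrow> real mat \<Rightarrow> real mat \<Rightarrow> tensor3" where
  "cp_tensor X Y Z = (\<lambda>abc \<in> {..<dim_row X} \<times> {..<dim_row Y} \<times> {..<dim_row Z}.
     \<Sum>i<dim_col X. outer3 (col X i) (col Y i) (col Z i) abc)"

text \<open>The window with \<open>u\<^sub>0 = c\<close>, future \<open>(u\<^sub>1, u\<^sub>2, \<dots>)\<close> and past \<open>(u\<^sub>-\<^sub>1, u\<^sub>-\<^sub>2, \<dots>)\<close>.\<close>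

definition window :: "nat list \<Rightarrow> nat list \<Rightarrow> nat \<Rightarrow> int \<Rightarrow> nat" where
  "window future past c t =
     (if t = 0 then c else if t > 0 then future ! nat (t - 1) else past ! nat (- t - 1))"

definition law_tensor :: "'a measure \<Rightarrow> (int \<Rightarrow> 'a \<Rightarrow> nat) \<Rightarrow> nat \<Rightarrow> nat \<Rightarrow> tensor3" where
  "law_tensor \<Omega> y d n = (\<lambda>(a, b, c) \<in> {..<d ^ n} \<times> {..<d ^ n} \<times> {..<d}.
     \<P>(\<omega> in \<Omega>. \<forall>t\<in>{- int n..int n}.
        y t \<omega> = window (word_of_index d n a) (word_of_index d n b) c t))"

lemma law_tensor_entry:
  fixes u :: "int \<Rightarrow> nat"
  assumes u: "\<And>t. t \<in> {- int n..int n} \<Longrightarrow> u t < d"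
  shows "law_tensor \<Omega> y d n
           (word_index d (map (\<lambda>i. u (int i)) [1..<Suc n]),
            word_index d (map (\<lambda>i. u (- int i)) [1..<Suc n]), u 0) =
         \<P>(\<omega> in \<Omega>. \<forall>t\<in>{- int n..int n}. y t \<omega> = u t)"
proof -
  define f where "f = map (\<lambda>i. u (int i)) [1..<Suc n]"
  define p where "p = map (\<lambda>i. u (- int i)) [1..<Suc n]"
  have f: "f \<in> words d n" and p: "p \<in> words d n"
    using u by (auto simp: f_def p_def words_def simp del: upt_Suc)
  have lt: "word_index d f < d ^ n" "word_index d p < d ^ n"
    using f p word_index_less[of f d] word_index_less[of p d] by (auto simp: words_def)
  have win: "window f p (u 0) t = u t" if "t \<in> {- int n..int n}" for t
  proof -
    consider "t = 0" | "t > 0" | "t < 0" by linarith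
    then show ?thesis
    proof cases
      case 2
      then show ?thesis using that
        by (auto simp: window_def f_def nth_upt nat_less_iff simp del: upt_Suc)
    next
      case 3
      then show ?thesis using that
        by (auto simp: window_def p_def nth_upt nat_less_iff simp del: upt_Suc)
    qed (simp add: window_def)
  qed
  have "law_tensor \<Omega> y d n (word_index d f, word_index d p, u 0) =
        \<P>(\<omega> in \<Omega>. \<forall>t\<in>{- int n..int n}. y t \<omega> = window f p (u 0) t)"
    using lt u[of 0] f p by (simp add: law_tensor_def word_of_index_word_index)
  also have "\<dots> = \<P>(\<omega> in \<Omega>. \<forall>t\<in>{- int n..int n}. y t \<omega> = u t)"
    using win by simp
  finally show ?thesis by (simp only: f_def p_def)
qed

text \<open>
  The row with number \<^term>\<open>word_index d us\<close> is \<open>v\<^sup>T I\<^bsub>u\<^sub>n\<^esub> Q \<dots> I\<^bsub>u\<^sub>1\<^esub> Q\<close>. With \<open>v = e\<close> this gives the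
  matrix \<open>A\<close>; with \<open>v = \<rho>\<close> and the transpose of \<open>Q\<close> in place of \<open>Q\<close> it gives the matrix \<open>B\<close>.
\<close>

definition word_matrix ::
    "nat \<Rightarrow> nat \<Rightarrow> nat \<Rightarrow> (nat \<Rightarrow> nat) \<Rightarrow> real mat \<Rightarrow> real vec \<Rightarrow> real mat" where
  "word_matrix d n k \<phi> Q v = mat (d ^ n) k
     (\<lambda>(l, j). (mat_of_row v * word_prod k \<phi> Q (word_of_index d n l)) $$ (0, j))"

lemma word_prod_carrier:
  "Q \<in> carrier_mat k k \<Longrightarrow> word_prod k \<phi> Q us \<in> carrier_mat k k"
  by (induction us) (auto simp: symbol_proj_def)

lemma row_word_matrix:
  assumes "Q \<in> carrier_mat k k" "v \<in> carrier_vec k" "us \<in> words d n"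
  shows "row (word_matrix d n k \<phi> Q v) (word_index d us) =
         row (mat_of_row v * word_prod k \<phi> Q us) 0"
proof -
  have "word_index d us < d ^ n"
    using assms(3) word_index_less by (auto simp: words_def)
  moreover have "dim_col (word_prod k \<phi> Q us) = k"
    using word_prod_carrier[OF assms(1)] by blast
  ultimately show ?thesis
    using assms(3)
    by (intro eq_vecI) (auto simp: word_matrix_def word_of_index_word_index)
qed

end

theory Submission
  imports Defs
begin

text \<open>
  Put \<open>b(u\<^sub>1, \<dots>, u\<^sub>m) = Q I\<^bsub>u\<^sub>1\<^esub> Q I\<^bsub>u\<^sub>2\<^esub> \<dots> Q I\<^bsub>u\<^sub>m\<^esub> \<rho>\<close>. By the Markov property its \<open>i\<close>th entry is
  the joint probability of the state \<open>i\<close> at time \<open>t\<close> and the observations \<open>u\<^sub>1, \<dots>, u\<^sub>m\<close> at the times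
  \<open>t - 1, \<dots>, t - m\<close>. Since \<open>e\<^sup>T Q = e\<^sup>T\<close>, the probability of a window with future \<open>f\<close>, present \<open>c\<close> and
  past \<open>p\<close> is \<open>e\<^sup>T W(f) I\<^sub>c b(p)\<close>, where \<open>W(f) = I\<^bsub>f\<^sub>n\<^esub> Q \<dots> I\<^bsub>f\<^sub>1\<^esub> Q\<close>; this is also the entry of
  \<open>A \<otimes> B \<otimes> C\<close>. The reduced model has entries of the same shape, because \<open>O T\<close> is again the 0-1
  matrix of its observation map, and both expressions agree because \<open>T\<close> intertwines
  \<open>Q\<close>, \<open>I\<^sub>u\<close>, \<open>\<rho>\<close> and \<open>e\<close> with their reduced counterparts.
\<close>

section \<open>Linear algebra\<close>

lemma symbol_proj_carrier [simp]: "symbol_proj k \<phi> u \<in> carrier_mat k k"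
  by (simp add: symbol_proj_def)

lemma symbol_proj_mult_vec:
  assumes "v \<in> carrier_vec k"
  shows "symbol_proj k \<phi> u *\<^sub>v v = vec k (\<lambda>i. if \<phi> i = u then v $ i else 0)"
proof (rule eq_vecI)
  fix i assume "i < dim_vec (vec k (\<lambda>i. if \<phi> i = u then v $ i else 0))"
  then have i: "i < k" by simp
  have "(symbol_proj k \<phi> u *\<^sub>v v) $ i =
      (\<Sum>j<k. (if i = j then if \<phi> j = u then 1 else 0 else 0) * v $ j)"
    using assms i unfolding symbol_proj_def
    by (simp add: mat_diag_def scalar_prod_def atLeast0LessThan)
  also have "\<dots> = (\<Sum>j<k. if i = j then if \<phi> j = u then v $ j else 0 else 0)"
    by (intro sum.cong) auto
  finally have "(symbol_proj k \<phi> u *\<^sub>v v) $ i =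
      (\<Sum>j<k. if i = j then if \<phi> j = u then v $ j else 0 else 0)" .
  then show "(symbol_proj k \<phi> u *\<^sub>v v) $ i = vec k (\<lambda>i. if \<phi> i = u then v $ i else 0) $ i"
    using i by simp
qed (simp add: symbol_proj_def mat_diag_def)

text \<open>A nonzero \<open>v - w\<close> would be a linear dependence between the columns of
  \<open>T\<close>. This injectivity gives the uniqueness behind the descriptions of
  \<open>Qh\<close> and \<open>\<rho>h\<close>.\<close>

lemma mult_mat_vec_inj_of_full_rank:
  fixes T :: "'f::field mat"
  assumes T: "T \<in> carrier_mat k r" and rank: "vec_space.rank k T = r"
    and v: "v \<in> carrier_vec r" and w: "w \<in> carrier_vec r" and eq: "T *\<^sub>v v = T *\<^sub>v w"
  shows "v = w"
proof -
  interpret vec_space "TYPE('f)" k .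
  \<comment> \<open>Linear independence refers to the set of columns, which hides repetitions, so
    these are excluded first: the rank is the size of a maximal independent subset of that set, and
    a repeated column leaves fewer than \<open>r\<close> candidates.\<close>
  have dist: "distinct (cols T)"
  proof (rule ccontr)
    assume "\<not> distinct (cols T)"
    then have lt: "card (set (cols T)) < r"
      using T card_distinct[of "cols T"] card_length[of "cols T"] by (auto simp: le_less)
    obtain S where S: "maximal S (\<lambda>U. U \<subseteq> set (cols T) \<and> lin_indpt U)"
      using maximal_exists_superset[of "set (cols T)" "\<lambda>U. U \<subseteq> set (cols T) \<and> lin_indpt U" "{}"]
      by (auto simp: lin_dep_def)
    then have "card S \<le> card (set (cols T))" by (simp add: card_mono maximal_def)
    then show False using lt rank_card_indpt[OF T S] rank by simp
  qed
  have "T *\<^sub>v (v - w) = 0\<^sub>v k"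
    using T v w eq by (simp add: mult_minus_distrib_mat_vec)
  then have "v - w = 0\<^sub>v r"
    using lin_depI[OF T _ _ _ dist, of "v - w"] full_rank_lin_indpt[OF T rank dist] v w by auto
  then have "(v - w) $ i = 0" if "i < r" for i using that by simp
  then show ?thesis
    using v w by (intro eq_vecI) auto
qed

text \<open>The vectors that \<open>A\<close> sends into the span of \<open>W'\<close> form a
  submodule; it contains the generators \<open>W\<close> and hence their span.\<close>

lemma mult_mat_vec_span_subset:
  fixes A :: "'f::field mat"
  assumes A: "A \<in> carrier_mat k k" and W: "W \<subseteq> carrier_vec k"
    and W': "W' \<subseteq> carrier_vec k"
    and gen: "\<And>w. w \<in> W \<Longrightarrow>
      A *\<^sub>v w \<in> LinearCombinations.module.span class_ring (module_vec TYPE('f) k) W'"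
    and v: "v \<in> LinearCombinations.module.span class_ring (module_vec TYPE('f) k) W"
  shows "A *\<^sub>v v \<in> LinearCombinations.module.span class_ring (module_vec TYPE('f) k) W'"
proof -
  interpret vec_space "TYPE('f)" k .
  let ?N = "{x \<in> carrier_vec k. A *\<^sub>v x \<in> span W'}"
  have sub: "submodule class_ring ?N V"
  proof (rule submodule.intro)
    show "Module.module class_ring V" by (rule module_axioms)
    fix x z assume "x \<in> ?N" "z \<in> ?N"
    then show "x \<oplus>\<^bsub>V\<^esub> z \<in> ?N"
      using A span_add1[OF W'] by (auto simp: mult_add_distrib_mat_vec)
  next
    have "0\<^sub>v k \<in> span W'" using submodule.zero_closed[OF span_is_submodule] W' by simp
    moreover have "A *\<^sub>v 0\<^sub>v k = 0\<^sub>v k" using A by (intro eq_vecI) auto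
    ultimately show "\<zero>\<^bsub>V\<^esub> \<in> ?N" by simp
  next
    fix c x assume "x \<in> ?N"
    then show "c \<odot>\<^bsub>V\<^esub> x \<in> ?N"
      using A smult_in_span[OF W'] by (auto simp: mult_mat_vec)
  qed auto
  have "W \<subseteq> ?N" using gen W by auto
  then have "span W \<subseteq> ?N" using span_is_subset[OF _ sub] by simp
  then show ?thesis using v by auto
qed


section \<open>Entries of the tensor of a state space model\<close>

fun backward_vec :: "nat \<Rightarrow> (nat \<Rightarrow> nat) \<Rightarrow> real mat \<Rightarrow> real vec \<Rightarrow> nat list \<Rightarrow> real vec" where
  "backward_vec k \<phi> Q \<rho> [] = \<rho>"
| "backward_vec k \<phi> Q \<rho> (u # us) =
     Q *\<^sub>v (symbol_proj k \<phi> u *\<^sub>v backward_vec k \<phi> Q \<rho> us)"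

lemma backward_vec_carrier:
  "Q \<in> carrier_mat k k \<Longrightarrow> \<rho> \<in> carrier_vec k \<Longrightarrow> backward_vec k \<phi> Q \<rho> us \<in> carrier_vec k"
  by (induction us) (simp_all add: mult_mat_vec_carrier[of _ k k])

lemma transpose_symbol_proj: "transpose_mat (symbol_proj k \<phi> u) = symbol_proj k \<phi> u"
  by (rule eq_matI) (auto simp: symbol_proj_def mat_diag_def)

text \<open>Each \<open>I\<^sub>u\<close> is symmetric, so transposition only reverses the factors
  and turns the transpose of \<open>Q\<close> back into \<open>Q\<close>. Thus the rows of
  \<open>B\<close> are backward vectors.\<close>

lemma transpose_word_prod_transpose:
  assumes Q: "Q \<in> carrier_mat k k" and \<rho>: "\<rho> \<in> carrier_vec k"
  shows "transpose_mat (word_prod k \<phi> (transpose_mat Q) us) *\<^sub>v \<rho> = backward_vec k \<phi> Q \<rho> us"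
proof (induction us)
  case Nil
  then show ?case using \<rho> by simp
next
  case (Cons u us)
  let ?W = "word_prod k \<phi> (transpose_mat Q) us" and ?I = "symbol_proj k \<phi> u"
  have W: "?W \<in> carrier_mat k k"
    using Q by (intro word_prod_carrier) simp
  have "transpose_mat (?W * (?I * transpose_mat Q)) = transpose_mat (?I * transpose_mat Q) * transpose_mat ?W"
    using W Q by (intro transpose_mult[of _ k k _ k] mult_carrier_mat[of _ k k]) simp_all
  also have "transpose_mat (?I * transpose_mat Q) = Q * ?I"
    using Q transpose_mult[of ?I k k "transpose_mat Q" k] by (simp add: transpose_symbol_proj)
  finally have "transpose_mat (word_prod k \<phi> (transpose_mat Q) (u # us)) *\<^sub>v \<rho> =
      (Q * ?I * transpose_mat ?W) *\<^sub>v \<rho>" by simp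
  also have "\<dots> = (Q * ?I) *\<^sub>v (transpose_mat ?W *\<^sub>v \<rho>)"
    using W Q \<rho> by (intro assoc_mult_mat_vec[of _ k k _ k]) auto
  also have "\<dots> = Q *\<^sub>v (?I *\<^sub>v (transpose_mat ?W *\<^sub>v \<rho>))"
    using W Q \<rho> by (intro assoc_mult_mat_vec[of _ k k _ k]) auto
  finally show ?case using Cons.IH by simp
qed

lemma mat_of_row_times_index:
  fixes v :: "'f::comm_ring_1 vec"
  assumes "W \<in> carrier_mat k k" "v \<in> carrier_vec k" "j < k"
  shows "(mat_of_row v * W) $$ (0, j) = (transpose_mat W *\<^sub>v v) $ j"
  using assms by (simp add: comm_scalar_prod[of v k])

lemma dim_word_matrix [simp]:
  "dim_row (word_matrix d n k \<phi> Q v) = d ^ n" "dim_col (word_matrix d n k \<phi> Q v) = k"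
  by (simp_all add: word_matrix_def)

lemma word_matrix_index:
  assumes "us \<in> words d n" "j < k"
  shows "word_matrix d n k \<phi> Q v $$ (word_index d us, j) =
    (mat_of_row v * word_prod k \<phi> Q us) $$ (0, j)"
proof -
  have "word_index d us < d ^ n"
    using assms(1) word_index_less by (auto simp: words_def)
  then show ?thesis
    using assms by (simp add: word_matrix_def word_of_index_word_index del: index_mult_mat)
qed

lemma word_matrix_transpose_index:
  assumes Q: "Q \<in> carrier_mat k k" and v: "v \<in> carrier_vec k" and us: "us \<in> words d n" and j: "j < k"
  shows "word_matrix d n k \<phi> (transpose_mat Q) v $$ (word_index d us, j) = backward_vec k \<phi> Q v us $ j"
proof -
  have "word_prod k \<phi> (transpose_mat Q) us \<in> carrier_mat k k"
    using Q by (intro word_prod_carrier) simp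
  then show ?thesis
    by (simp only: word_matrix_index[OF us j] mat_of_row_times_index[OF _ v j]
        transpose_word_prod_transpose[OF Q v])
qed

lemma sum_mat_of_row_times:
  fixes e z :: "'f::comm_ring_1 vec"
  assumes W: "W \<in> carrier_mat k k" and e: "e \<in> carrier_vec k" and z: "z \<in> carrier_vec k"
  shows "(\<Sum>i<k. (mat_of_row e * W) $$ (0, i) * z $ i) = e \<bullet> (W *\<^sub>v z)"
proof -
  have "(\<Sum>i<k. (mat_of_row e * W) $$ (0, i) * z $ i) = ((mat_of_row e * W) *\<^sub>v z) $ 0"
    using e W z by (simp add: scalar_prod_def atLeast0LessThan)
  also have "\<dots> = (mat_of_row e *\<^sub>v (W *\<^sub>v z)) $ 0"
    by (simp only: assoc_mult_mat_vec[OF mat_of_row_carrier(1)[OF e] W z])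
  finally show ?thesis by simp
qed

lemma dim_obs_mat [simp]: "dim_row (obs_mat d k \<phi>) = d" "dim_col (obs_mat d k \<phi>) = k"
  by (simp_all add: obs_mat_def)

lemma obs_mat_index [simp]:
  "i < d \<Longrightarrow> j < k \<Longrightarrow> obs_mat d k \<phi> $$ (i, j) = (if \<phi> j = i then 1 else 0)"
  by (simp add: obs_mat_def)

lemma cp_tensor_entry:
  assumes "a < dim_row X" "b < dim_row Y" "c < dim_row Z"
    and "dim_col Y = dim_col X" "dim_col Z = dim_col X"
  shows "cp_tensor X Y Z (a, b, c) = (\<Sum>i<dim_col X. X $$ (a, i) * Y $$ (b, i) * Z $$ (c, i))"
  using assms by (simp add: cp_tensor_def outer3_def)

text \<open>The summation index runs over the present state, and the 0-1 entry of the observation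
  matrix acts as \<open>I\<^sub>c\<close> on the backward vector; what remains is a row times a
  column. Being purely algebraic, the formula serves the given and the reduced model alike.\<close>

lemma cp_tensor_word_matrix:
  assumes Q: "Q \<in> carrier_mat k k" and e: "e \<in> carrier_vec k" and \<rho>: "\<rho> \<in> carrier_vec k"
    and f: "f \<in> words d n" and p: "p \<in> words d n" and c: "c < d"
  shows "cp_tensor (word_matrix d n k \<phi> Q e) (word_matrix d n k \<phi> (transpose_mat Q) \<rho>)
           (obs_mat d k \<phi>) (word_index d f, word_index d p, c) =
         e \<bullet> (word_prod k \<phi> Q f *\<^sub>v (symbol_proj k \<phi> c *\<^sub>v backward_vec k \<phi> Q \<rho> p))"
proof -
  let ?W = "word_prod k \<phi> Q f" and ?b = "backward_vec k \<phi> Q \<rho> p"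
  let ?z = "symbol_proj k \<phi> c *\<^sub>v ?b"
  have W: "?W \<in> carrier_mat k k" using Q by (rule word_prod_carrier)
  have b: "?b \<in> carrier_vec k" using Q \<rho> by (rule backward_vec_carrier)
  have z: "?z \<in> carrier_vec k" using b by (simp add: symbol_proj_mult_vec)
  have lt: "word_index d f < d ^ n" "word_index d p < d ^ n"
    using f p word_index_less[of f d] word_index_less[of p d] by (auto simp: words_def)
  have "cp_tensor (word_matrix d n k \<phi> Q e) (word_matrix d n k \<phi> (transpose_mat Q) \<rho>)
           (obs_mat d k \<phi>) (word_index d f, word_index d p, c) =
        (\<Sum>i<k. (mat_of_row e * ?W) $$ (0, i) * ?b $ i * (if \<phi> i = c then 1 else 0))"
    using lt c
    by (subst cp_tensor_entry) (auto simp only: dim_word_matrix dim_obs_mat obs_mat_index lessThan_iff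
        word_matrix_index[OF f] word_matrix_transpose_index[OF Q \<rho> p] intro!: sum.cong)
  also have "\<dots> = (\<Sum>i<k. (mat_of_row e * ?W) $$ (0, i) * ?z $ i)"
    using b by (intro sum.cong) (simp_all add: symbol_proj_mult_vec)
  also have "\<dots> = e \<bullet> (?W *\<^sub>v ?z)"
    using W e z by (rule sum_mat_of_row_times)
  finally show ?thesis .
qed

lemma word_prod_Cons_mult_vec:
  assumes Q: "Q \<in> carrier_mat k k" and v: "v \<in> carrier_vec k"
  shows "word_prod k \<phi> Q (u # us) *\<^sub>v v = word_prod k \<phi> Q us *\<^sub>v (symbol_proj k \<phi> u *\<^sub>v (Q *\<^sub>v v))"
proof -
  have W: "word_prod k \<phi> Q us \<in> carrier_mat k k" using Q by (rule word_prod_carrier)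
  have "word_prod k \<phi> Q (u # us) *\<^sub>v v = word_prod k \<phi> Q us *\<^sub>v ((symbol_proj k \<phi> u * Q) *\<^sub>v v)"
    unfolding word_prod.simps
    by (rule assoc_mult_mat_vec[OF W mult_carrier_mat[OF symbol_proj_carrier Q] v])
  also have "(symbol_proj k \<phi> u * Q) *\<^sub>v v = symbol_proj k \<phi> u *\<^sub>v (Q *\<^sub>v v)"
    by (rule assoc_mult_mat_vec[OF symbol_proj_carrier Q v])
  finally show ?thesis .
qed

section \<open>Intertwined models\<close>

context
  fixes k r :: nat and \<phi> \<phi>h :: "nat \<Rightarrow> nat" and Q Qh T :: "real mat"
  assumes Q: "Q \<in> carrier_mat k k" and Qh: "Qh \<in> carrier_mat r r" and T: "T \<in> carrier_mat k r"
    and intertwine: "Q * T = T * Qh"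
    and block: "\<And>i j. i < k \<Longrightarrow> j < r \<Longrightarrow> \<phi> i \<noteq> \<phi>h j \<Longrightarrow> T $$ (i, j) = 0"
begin

lemma intertwine_mult_vec:
  "z \<in> carrier_vec r \<Longrightarrow> Q *\<^sub>v (T *\<^sub>v z) = T *\<^sub>v (Qh *\<^sub>v z)"
  using assoc_mult_mat_vec[OF Q T] assoc_mult_mat_vec[OF T Qh] intertwine by simp

text \<open>Row \<open>i\<close> of \<open>T\<close> is supported on the columns \<open>j\<close>
  with \<open>\<phi>h j = \<phi> i\<close>. Selecting the rows of symbol \<open>u\<close> therefore
  keeps the same entries as selecting the columns of symbol \<open>u\<close>.\<close>

lemma intertwine_symbol_proj:
  assumes z: "z \<in> carrier_vec r"
  shows "symbol_proj k \<phi> u *\<^sub>v (T *\<^sub>v z) = T *\<^sub>v (symbol_proj r \<phi>h u *\<^sub>v z)"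
proof (rule eq_vecI)
  fix i assume "i < dim_vec (T *\<^sub>v (symbol_proj r \<phi>h u *\<^sub>v z))"
  then have i: "i < k" using T by simp
  have "(if \<phi> i = u then \<Sum>j<r. T $$ (i, j) * z $ j else 0) =
      (\<Sum>j<r. T $$ (i, j) * (if \<phi>h j = u then z $ j else 0))"
    using block[OF i] by (auto intro!: sum.cong sum.neutral)
  then show "(symbol_proj k \<phi> u *\<^sub>v (T *\<^sub>v z)) $ i = (T *\<^sub>v (symbol_proj r \<phi>h u *\<^sub>v z)) $ i"
    using i T z
    by (simp add: symbol_proj_mult_vec scalar_prod_def atLeast0LessThan split: if_splits)
qed (use T in \<open>simp add: symbol_proj_def mat_diag_def\<close>)

lemma intertwine_backward_vec:
  assumes z: "z \<in> carrier_vec r"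
  shows "backward_vec k \<phi> Q (T *\<^sub>v z) us = T *\<^sub>v backward_vec r \<phi>h Qh z us"
proof (induction us)
  case (Cons u us)
  have b: "backward_vec r \<phi>h Qh z us \<in> carrier_vec r" using Qh z by (rule backward_vec_carrier)
  then have "symbol_proj r \<phi>h u *\<^sub>v backward_vec r \<phi>h Qh z us \<in> carrier_vec r"
    by (simp only: symbol_proj_mult_vec vec_carrier)
  with b show ?case
    using Cons by (simp only: backward_vec.simps intertwine_symbol_proj intertwine_mult_vec)
qed simp

lemma intertwine_word_prod:
  assumes "z \<in> carrier_vec r"
  shows "word_prod k \<phi> Q us *\<^sub>v (T *\<^sub>v z) = T *\<^sub>v (word_prod r \<phi>h Qh us *\<^sub>v z)"
  using assms
\<comment> \<open>The head symbol acts first, so the induction hypothesis is applied to the vector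
  after that step, not to \<open>z\<close> itself.\<close>
proof (induction us arbitrary: z)
  case Nil
  then show ?case using T by simp
next
  case (Cons u us)
  let ?W = "word_prod k \<phi> Q us" and ?Wh = "word_prod r \<phi>h Qh us"
  have Tz: "T *\<^sub>v z \<in> carrier_vec k" using T Cons.prems by simp
  have Qz: "Qh *\<^sub>v z \<in> carrier_vec r" using Qh Cons.prems by simp
  have IQz: "symbol_proj r \<phi>h u *\<^sub>v (Qh *\<^sub>v z) \<in> carrier_vec r"
    using Qz by (simp add: symbol_proj_mult_vec)
  have "word_prod k \<phi> Q (u # us) *\<^sub>v (T *\<^sub>v z) = ?W *\<^sub>v (symbol_proj k \<phi> u *\<^sub>v (Q *\<^sub>v (T *\<^sub>v z)))"
    using Q Tz by (rule word_prod_Cons_mult_vec)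
  also have "\<dots> = ?W *\<^sub>v (T *\<^sub>v (symbol_proj r \<phi>h u *\<^sub>v (Qh *\<^sub>v z)))"
    using Cons.prems Qz by (simp only: intertwine_symbol_proj intertwine_mult_vec)
  also have "\<dots> = T *\<^sub>v (?Wh *\<^sub>v (symbol_proj r \<phi>h u *\<^sub>v (Qh *\<^sub>v z)))"
    using IQz by (rule Cons.IH)
  also have "\<dots> = T *\<^sub>v (word_prod r \<phi>h Qh (u # us) *\<^sub>v z)"
    using Qh Cons.prems by (simp only: word_prod_Cons_mult_vec)
  finally show ?case .
qed

end

section \<open>Regrouping word products, and column sums\<close>

text \<open>The recursion of \<open>word_prod\<close> adds factors on the right; here one is added
  on the left. Hence \<open>I\<^sub>a Q\<close> maps generators of the reachable subspace to
  generators.\<close>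

lemma word_prod_snoc_mult_vec:
  assumes Q: "Q \<in> carrier_mat k k" and "v \<in> carrier_vec k"
  shows "word_prod k \<phi> Q (us @ [a]) *\<^sub>v v = symbol_proj k \<phi> a *\<^sub>v (Q *\<^sub>v (word_prod k \<phi> Q us *\<^sub>v v))"
  using assms(2)
proof (induction us arbitrary: v)
  case Nil
  then have "Q *\<^sub>v v \<in> carrier_vec k" using Q by simp
  then have "symbol_proj k \<phi> a *\<^sub>v (Q *\<^sub>v v) \<in> carrier_vec k" by (simp only: symbol_proj_mult_vec vec_carrier)
  then show ?case
    using word_prod_Cons_mult_vec[OF Q Nil, of \<phi> a "[]"] Nil by simp
next
  case (Cons u us)
  have "Q *\<^sub>v v \<in> carrier_vec k" using Q Cons.prems by simp
  then have "symbol_proj k \<phi> u *\<^sub>v (Q *\<^sub>v v) \<in> carrier_vec k" by (simp only: symbol_proj_mult_vec vec_carrier)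
  then show ?case
    using Cons.IH by (simp only: append_Cons word_prod_Cons_mult_vec[OF Q Cons.prems])
qed

text \<open>Both sides are the same product, grouped into steps \<open>Q I\<close> or into steps
  \<open>I Q\<close>; the extra \<open>Q\<close> on the right-hand side completes the pairing. The
  future is reversed because backward words start at the latest time.\<close>

lemma backward_vec_rev_append:
  assumes Q: "Q \<in> carrier_mat k k" and \<rho>: "\<rho> \<in> carrier_vec k"
  shows "backward_vec k \<phi> Q \<rho> (rev f @ c # p) =
    Q *\<^sub>v (word_prod k \<phi> Q f *\<^sub>v (symbol_proj k \<phi> c *\<^sub>v backward_vec k \<phi> Q \<rho> p))"
\<comment> \<open>The first future symbol becomes the present and the old present joins the past, so
  both must vary.\<close>
proof (induction f arbitrary: c p)
  case Nil
  have "backward_vec k \<phi> Q \<rho> p \<in> carrier_vec k" using Q \<rho> by (rule backward_vec_carrier)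
  then show ?case by (simp add: symbol_proj_mult_vec)
next
  case (Cons u us)
  have b: "backward_vec k \<phi> Q \<rho> p \<in> carrier_vec k" using Q \<rho> by (rule backward_vec_carrier)
  have z: "symbol_proj k \<phi> c *\<^sub>v backward_vec k \<phi> Q \<rho> p \<in> carrier_vec k"
    using b by (simp only: symbol_proj_mult_vec vec_carrier)
  show ?case
    using Cons.IH[of u "c # p"]
    by (simp only: rev.simps append_assoc append_Cons append_Nil backward_vec.simps
        word_prod_Cons_mult_vec[OF Q z])
qed

lemma ones_scalar_prod:
  assumes "v \<in> carrier_vec k"
  shows "ones k \<bullet> v = (\<Sum>i<k. v $ i)"
  using assms by (simp add: ones_def scalar_prod_def atLeast0LessThan)

text \<open>Exchanging the sums exposes the column sums of \<open>Q\<close>; this is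
  \<open>e\<^sup>T Q = e\<^sup>T\<close>.\<close>

lemma ones_scalar_prod_stochastic:
  assumes Q: "Q \<in> carrier_mat k k" and v: "v \<in> carrier_vec k"
    and "\<And>j. j < k \<Longrightarrow> (\<Sum>i<k. Q $$ (i, j)) = 1"
  shows "ones k \<bullet> (Q *\<^sub>v v) = ones k \<bullet> v"
proof -
  have "ones k \<bullet> (Q *\<^sub>v v) = (\<Sum>i<k. \<Sum>j<k. Q $$ (i, j) * v $ j)"
    using Q v by (subst ones_scalar_prod) (simp_all add: scalar_prod_def atLeast0LessThan)
  also have "\<dots> = (\<Sum>j<k. (\<Sum>i<k. Q $$ (i, j)) * v $ j)"
    by (subst sum.swap) (simp add: sum_distrib_right)
  finally show ?thesis using assms by (simp add: ones_scalar_prod)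
qed

section \<open>Invariance of the reachable subspace\<close>

text \<open>The projections \<open>I\<^sub>u\<close> with \<open>u < d\<close> add up to the
  identity, because \<open>\<phi>\<close> assigns to each state exactly one symbol below
  \<open>d\<close>.\<close>

lemma sum_symbol_proj_in_span:
  assumes v: "v \<in> carrier_vec k" and \<phi>: "\<phi> \<in> {..<k} \<rightarrow> {..<d}" and W: "W \<subseteq> carrier_vec k"
    and proj: "\<And>u. u < d \<Longrightarrow> symbol_proj k \<phi> u *\<^sub>v v \<in>
      LinearCombinations.module.span class_ring (module_vec TYPE(real) k) W"
  shows "v \<in> LinearCombinations.module.span class_ring (module_vec TYPE(real) k) W"
proof -
  interpret vec_space "TYPE(real)" k .
  let ?xs = "map (\<lambda>u. symbol_proj k \<phi> u *\<^sub>v v) [0..<d]"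
  have xs: "set ?xs \<subseteq> carrier_vec k" using v by (auto simp: symbol_proj_mult_vec)
  have "M.sumlist ?xs = v"
  proof (rule eq_vecI)
    fix i assume "i < dim_vec v"
    then have i: "i < k" using v by simp
    have "M.sumlist ?xs $ i = (\<Sum>u<d. (symbol_proj k \<phi> u *\<^sub>v v) $ i)"
      using xs i by (subst sumlist_nth) (auto simp: atLeast0LessThan symbol_proj_mult_vec v)
    also have "\<dots> = (\<Sum>u<d. if \<phi> i = u then v $ i else 0)"
      using v i by (simp add: symbol_proj_mult_vec)
    also have "\<dots> = v $ i" using \<phi> i by auto
    finally show "M.sumlist ?xs $ i = v $ i" .
  qed (use xs v in \<open>simp add: dim_sumlist\<close>)
  moreover have "M.sumlist ?xs \<in> span W" using proj by (intro sumlist_in_span[OF W]) auto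
  ultimately show ?thesis by simp
qed

text \<open>
  Generators of the reachable subspace begin with some \<open>I\<^sub>u\<close>, so neither \<open>\<rho>\<close> nor the image of a
  generator under \<open>Q\<close> need be one; both are sums of their projections, which are generators.
\<close>

lemma
  assumes Q: "Q \<in> carrier_mat k k" and \<rho>: "\<rho> \<in> carrier_vec k" and \<phi>: "\<phi> \<in> {..<k} \<rightarrow> {..<d}"
  shows mem_reachable_subspace: "\<rho> \<in> reachable_subspace d k \<phi> Q \<rho>"
    and reachable_subspace_invariant:
      "v \<in> reachable_subspace d k \<phi> Q \<rho> \<Longrightarrow> Q *\<^sub>v v \<in> reachable_subspace d k \<phi> Q \<rho>"
proof -
  interpret vec_space "TYPE(real)" k .
  let ?G = "{word_prod k \<phi> Q us *\<^sub>v (symbol_proj k \<phi> u *\<^sub>v \<rho>) | u us. u < d \<and> set us \<subseteq> {..<d}}"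
  have W: "word_prod k \<phi> Q us \<in> carrier_mat k k" for us using Q by (rule word_prod_carrier)
  have I\<rho>: "symbol_proj k \<phi> u *\<^sub>v \<rho> \<in> carrier_vec k" for u
    using \<rho> by (simp add: symbol_proj_mult_vec)
  have G: "?G \<subseteq> carrier_vec k" using mult_mat_vec_carrier[OF W I\<rho>] by blast
  show "\<rho> \<in> reachable_subspace d k \<phi> Q \<rho>"
    unfolding reachable_subspace_def
  proof (rule sum_symbol_proj_in_span[OF \<rho> \<phi> G])
    fix u assume "u < d"
    \<comment> \<open>The empty word makes \<open>I\<^sub>u \<rho>\<close> a generator.\<close>
    then have "word_prod k \<phi> Q [] *\<^sub>v (symbol_proj k \<phi> u *\<^sub>v \<rho>) \<in> ?G"
      by (intro CollectI exI[of _ u] exI[of _ "[]"]) auto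
    then have "symbol_proj k \<phi> u *\<^sub>v \<rho> \<in> ?G"
      using I\<rho>[of u] by (simp only: word_prod.simps one_mult_mat_vec)
    then show "symbol_proj k \<phi> u *\<^sub>v \<rho> \<in> span ?G"
      using G by (intro span_mem) simp_all
  qed
  assume "v \<in> reachable_subspace d k \<phi> Q \<rho>"
  then show "Q *\<^sub>v v \<in> reachable_subspace d k \<phi> Q \<rho>"
    unfolding reachable_subspace_def
  proof (rule mult_mat_vec_span_subset[OF Q G G, rotated])
    fix g assume "g \<in> ?G"
    then obtain u us where u: "u < d" "set us \<subseteq> {..<d}"
      and g: "g = word_prod k \<phi> Q us *\<^sub>v (symbol_proj k \<phi> u *\<^sub>v \<rho>)" by blast
    have gc: "g \<in> carrier_vec k" unfolding g by (rule mult_mat_vec_carrier[OF W I\<rho>])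
    show "Q *\<^sub>v g \<in> span ?G"
    proof (rule sum_symbol_proj_in_span[OF _ \<phi> G])
      show "Q *\<^sub>v g \<in> carrier_vec k" using Q gc by simp
      fix a assume a: "a < d"
      \<comment> \<open>Applying \<open>I\<^sub>a Q\<close> to a generator appends \<open>a\<close>
        to its word, so each projection of \<open>Q g\<close> is again a generator.\<close>
      have "symbol_proj k \<phi> a *\<^sub>v (Q *\<^sub>v g) =
          word_prod k \<phi> Q (us @ [a]) *\<^sub>v (symbol_proj k \<phi> u *\<^sub>v \<rho>)"
        unfolding g using Q I\<rho> by (rule word_prod_snoc_mult_vec[symmetric])
      then have "symbol_proj k \<phi> a *\<^sub>v (Q *\<^sub>v g) \<in> ?G"
        using a u by (intro CollectI exI[of _ u] exI[of _ "us @ [a]"]) auto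
      then show "symbol_proj k \<phi> a *\<^sub>v (Q *\<^sub>v g) \<in> span ?G"
        using G by (intro span_mem) simp_all
    qed
  qed
qed

section \<open>Observation probabilities of a stationary Markov chain\<close>

lemma sets_Collect_coordinate:
  assumes "f \<in> measurable M (count_space A)"
  shows "{\<omega> \<in> space M. P (f \<omega>)} \<in> sets M"
proof -
  have "{\<omega> \<in> space M. P (f \<omega>)} = f -` {a \<in> A. P a} \<inter> space M"
    using measurable_space[OF assms] by auto
  then show ?thesis using measurable_sets[OF assms, of "{a \<in> A. P a}"] by simp
qed

text \<open>This turns equalities of laws, such as stationarity and the realization property, into
  equalities of probabilities of finite-time events.\<close>

lemma measure_process_law:
  assumes z: "\<And>t. z t \<in> measurable M (count_space {..<m})" and R: "finite R"
  shows "measure (process_law M m z) {f \<in> space (\<Pi>\<^sub>M t\<in>UNIV. count_space {..<m}). \<forall>r\<in>R. f r = s r} =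
    \<P>(\<omega> in M. \<forall>r\<in>R. z r \<omega> = s r)"
proof -
  let ?N = "\<Pi>\<^sub>M t\<in>(UNIV :: int set). count_space {..<m}"
  have law: "(\<lambda>\<omega> t. z t \<omega>) \<in> measurable M ?N"
    using z measurable_space[OF z] by (intro measurable_PiM_single') (auto simp: space_PiM)
  have "{f \<in> space ?N. f r = s r} \<in> sets ?N" for r
    by (rule sets_Collect_coordinate[where A = "{..<m}"]) simp
  then have ev: "{f \<in> space ?N. \<forall>r\<in>R. f r = s r} \<in> sets ?N"
    using R by (rule sets.sets_Collect_finite_All)
  show ?thesis
    unfolding process_law_def measure_distr[OF law ev]
    using measurable_space[OF law] by (intro arg_cong[of _ _ "measure M"]) auto
qed

context
  fixes \<Omega> :: "'b measure" and k :: nat and x :: "int \<Rightarrow> 'b \<Rightarrow> nat" and Q :: "real mat"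
  assumes markov: "stationary_markov_chain \<Omega> k x Q"
begin

lemma chain_prob_space: "prob_space \<Omega>"
  and chain_measurable: "x t \<in> measurable \<Omega> (count_space {..<k})"
  and chain_carrier: "Q \<in> carrier_mat k k"
  and chain_column_sum: "j < k \<Longrightarrow> (\<Sum>i<k. Q $$ (i, j)) = 1"
  using markov by (auto simp: stationary_markov_chain_def stationary_process_def)

lemma chain_state_less: "\<omega> \<in> space \<Omega> \<Longrightarrow> x t \<omega> < k"
  using measurable_space[OF chain_measurable] by auto

lemma chain_state_event: "{\<omega> \<in> space \<Omega>. x t \<omega> = i} \<in> sets \<Omega>"
  using chain_measurable by (rule sets_Collect_coordinate)

lemma chain_observation_event:
  "{\<omega> \<in> space \<Omega>. \<forall>l<m. \<phi> (x (t - int l) \<omega>) = us ! l} \<in> sets \<Omega>"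
proof -
  have "{\<omega> \<in> space \<Omega>. \<forall>l\<in>{..<m}. \<phi> (x (t - int l) \<omega>) = us ! l} \<in> sets \<Omega>"
  proof (rule sets.sets_Collect_finite_All)
    fix l show "{\<omega> \<in> space \<Omega>. \<phi> (x (t - int l) \<omega>) = us ! l} \<in> sets \<Omega>"
      using chain_measurable by (rule sets_Collect_coordinate)
  qed simp
  then show ?thesis by (simp only: Ball_def lessThan_iff)
qed

text \<open>This is the Markov property in product form, which also covers null paths: there
  conditioning says nothing, but both sides are zero.\<close>

lemma chain_step_path:
  assumes i: "i < k" and s: "s t < k"
  shows "\<P>(\<omega> in \<Omega>. x (t + 1) \<omega> = i \<and> (\<forall>r\<in>{t - int m..t}. x r \<omega> = s r)) =
    Q $$ (i, s t) * \<P>(\<omega> in \<Omega>. \<forall>r\<in>{t - int m..t}. x r \<omega> = s r)"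
proof -
  interpret prob_space \<Omega> by (rule chain_prob_space)
  let ?path = "\<lambda>\<omega>. \<forall>r\<in>{t - int m..t}. x r \<omega> = s r"
  have path: "{\<omega> \<in> space \<Omega>. ?path \<omega>} \<in> events"
    by (intro sets.sets_Collect_finite_All chain_state_event) simp
  show ?thesis
  proof (cases "\<P>(\<omega> in \<Omega>. ?path \<omega>) = 0")
    case True
    have "\<P>(\<omega> in \<Omega>. x (t + 1) \<omega> = i \<and> ?path \<omega>) \<le> \<P>(\<omega> in \<Omega>. ?path \<omega>)"
      using path by (intro finite_measure_mono) auto
    then show ?thesis using True by (simp add: measure_le_0_iff)
  next
    case False
    then have pos: "\<P>(\<omega> in \<Omega>. ?path \<omega>) > 0" by (simp add: zero_less_measure_iff)
    \<comment> \<open>A path of positive probability ends in a state of positive probability, as is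
      required for reading the transition probability off \<open>Q\<close>.\<close>
    also have "\<P>(\<omega> in \<Omega>. ?path \<omega>) \<le> \<P>(\<omega> in \<Omega>. x t \<omega> = s t)"
      using chain_state_event by (intro finite_measure_mono) auto
    finally have pos': "\<P>(\<omega> in \<Omega>. x t \<omega> = s t) > 0" .
    have "\<P>(\<omega> in \<Omega>. x (t + 1) \<omega> = i \<bar> ?path \<omega>) = \<P>(\<omega> in \<Omega>. x (t + 1) \<omega> = i \<bar> x t \<omega> = s t)"
      using markov i pos unfolding stationary_markov_chain_def by blast
    also have "\<dots> = Q $$ (i, s t)"
      using markov i s pos' unfolding stationary_markov_chain_def by blast
    finally show ?thesis using False by (simp add: cond_prob_def field_simps)
  qed
qed

text \<open>Since \<open>H\<close> depends only on the times from \<open>t - m\<close> to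
  \<open>t\<close>, the event is a finite disjoint union of paths, and all paths ending in
  \<open>j\<close> carry the same factor \<open>Q $$ (i, j)\<close>.\<close>

lemma chain_step:
  assumes i: "i < k" and j: "j < k"
    and H: "\<And>z z'. (\<And>r. r \<in> {t - int m..t} \<Longrightarrow> z r = z' r) \<Longrightarrow> H z = H z'"
  shows "\<P>(\<omega> in \<Omega>. x (t + 1) \<omega> = i \<and> x t \<omega> = j \<and> H (\<lambda>r. x r \<omega>)) =
    Q $$ (i, j) * \<P>(\<omega> in \<Omega>. x t \<omega> = j \<and> H (\<lambda>r. x r \<omega>))"
proof -
  interpret prob_space \<Omega> by (rule chain_prob_space)
  define R where "R = {t - int m..t}"
  \<comment> \<open>Functions on \<open>R\<close> alone form a finite set, and distinct ones
    describe disjoint events.\<close>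
  define S where "S = {s \<in> R \<rightarrow>\<^sub>E {..<k}. s t = j \<and> H s}"
  define path where "path s = {\<omega> \<in> space \<Omega>. \<forall>r\<in>R. x r \<omega> = s r}" for s
  define nextp where "nextp s = {\<omega> \<in> space \<Omega>. x (t + 1) \<omega> = i \<and> (\<forall>r\<in>R. x r \<omega> = s r)}" for s
  have tR: "t \<in> R" and finR: "finite R" by (simp_all add: R_def)
  have finS: "finite S" unfolding S_def using finR by (simp add: finite_PiE)
  have path_ev: "path s \<in> events" for s
    unfolding path_def using finR by (intro sets.sets_Collect_finite_All chain_state_event)
  have next_ev: "nextp s \<in> events" for s
    unfolding nextp_def using finR
    by (intro sets.sets_Collect_conj sets.sets_Collect_finite_All chain_state_event)
  have disj: "disjoint_family_on path S"
    unfolding disjoint_family_on_def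
  proof (intro ballI impI equals0I)
    fix s s' \<omega> assume "s \<in> S" "s' \<in> S" "s \<noteq> s'" "\<omega> \<in> path s \<inter> path s'"
    then show False
      using PiE_ext[of s R "\<lambda>_. {..<k}" s'] by (auto simp: S_def path_def)
  qed
  then have disj': "disjoint_family_on nextp S"
    unfolding disjoint_family_on_def path_def nextp_def by fast
  have in_path: "\<exists>s\<in>S. \<omega> \<in> path s" if "\<omega> \<in> space \<Omega>" "x t \<omega> = j" "H (\<lambda>r. x r \<omega>)" for \<omega>
  proof (intro bexI)
    let ?s = "restrict (\<lambda>r. x r \<omega>) R"
    show "\<omega> \<in> path ?s" using that by (simp add: path_def)
    have "H ?s = H (\<lambda>r. x r \<omega>)" by (rule H) (simp add: R_def)
    then show "?s \<in> S" using that tR chain_state_less by (auto simp: S_def)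
  qed
  have of_path: "x t \<omega> = j \<and> H (\<lambda>r. x r \<omega>)" if "s \<in> S" "\<omega> \<in> path s" for s \<omega>
  proof -
    have "H (\<lambda>r. x r \<omega>) = H s" using that by (intro H) (simp add: path_def R_def)
    then show ?thesis using that tR by (auto simp: S_def path_def)
  qed
  have U: "{\<omega> \<in> space \<Omega>. x t \<omega> = j \<and> H (\<lambda>r. x r \<omega>)} = (\<Union>s\<in>S. path s)"
    using in_path of_path by (auto simp: path_def)
  have U': "{\<omega> \<in> space \<Omega>. x (t + 1) \<omega> = i \<and> x t \<omega> = j \<and> H (\<lambda>r. x r \<omega>)} = (\<Union>s\<in>S. nextp s)"
  proof -
    have "nextp s = {\<omega> \<in> path s. x (t + 1) \<omega> = i}" for s by (auto simp: nextp_def path_def)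
    then show ?thesis using U by blast
  qed
  have "prob (\<Union>s\<in>S. nextp s) = (\<Sum>s\<in>S. prob (nextp s))"
    using finS next_ev disj' by (intro finite_measure_finite_Union) auto
  also have "\<dots> = (\<Sum>s\<in>S. Q $$ (i, j) * prob (path s))"
  proof (rule sum.cong[OF refl])
    fix s assume "s \<in> S"
    then have "s t = j" by (simp add: S_def)
    then show "prob (nextp s) = Q $$ (i, j) * prob (path s)"
      using chain_step_path[OF i, of s t m] j by (simp add: nextp_def path_def R_def)
  qed
  also have "\<dots> = Q $$ (i, j) * prob (\<Union>s\<in>S. path s)"
    using finS path_ev disj by (subst finite_measure_finite_Union) (auto simp: sum_distrib_left)
  finally show ?thesis by (simp only: U U')
qed

text \<open>Evaluating the shifted and the original law at the event that coordinate 0 is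
  \<open>i\<close> moves time \<open>t\<close> to time 0.\<close>

lemma chain_stationary:
  assumes "i < k"
  shows "\<P>(\<omega> in \<Omega>. x t \<omega> = i) = state_distribution \<Omega> k x $ i"
proof -
  have "process_law \<Omega> k (\<lambda>r. x (r + t)) = process_law \<Omega> k x"
    using markov by (simp add: stationary_markov_chain_def stationary_process_def)
  then show ?thesis
    using assms measure_process_law[of "\<lambda>r. x (r + t)" \<Omega> k "{0}" "\<lambda>_. i"]
      measure_process_law[of x \<Omega> k "{0}" "\<lambda>_. i"] chain_measurable
    by (simp add: state_distribution_def)
qed

text \<open>The event is split by the state \<open>j\<close> at time \<open>t - 1\<close>: it must
  carry the head symbol, the step from \<open>j\<close> to \<open>i\<close> gives the factor
  \<open>Q $$ (i, j)\<close>, and the rest is the same kind of event one time unit earlier.\<close>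

lemma chain_backward_vec:
  assumes "i < k"
  shows "\<P>(\<omega> in \<Omega>. x t \<omega> = i \<and> (\<forall>l<length us. \<phi> (x (t - 1 - int l) \<omega>) = us ! l)) =
    backward_vec k \<phi> Q (state_distribution \<Omega> k x) us $ i"
  using assms
proof (induction us arbitrary: t i)
  case Nil
  then show ?case by (simp add: chain_stationary)
next
  case (Cons u us)
  interpret prob_space \<Omega> by (rule chain_prob_space)
  define b where "b = backward_vec k \<phi> Q (state_distribution \<Omega> k x) us"
  \<comment> \<open>The observations older than time \<open>t - 1\<close>, as a predicate on
    trajectories. The unsimplified times here and in \<open>E\<close> match the induction hypothesis
    and \<open>chain_step\<close> at time \<open>t - 1\<close>.\<close>
  define H where "H z = (\<forall>l<length us. \<phi> (z (t - 1 - 1 - int l)) = us ! l)" for z :: "int \<Rightarrow> nat"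
  define E where "E j = {\<omega> \<in> space \<Omega>. x (t - 1 + 1) \<omega> = i \<and> x (t - 1) \<omega> = j \<and> H (\<lambda>r. x r \<omega>)}" for j
  have b: "b \<in> carrier_vec k"
    unfolding b_def using chain_carrier by (rule backward_vec_carrier) (simp add: state_distribution_def)
  have E_ev: "E j \<in> events" for j
    unfolding E_def H_def
    by (intro sets.sets_Collect_conj chain_state_event chain_observation_event)
  have E_prob: "prob (E j) = Q $$ (i, j) * b $ j" if "j < k" for j
  proof -
    have "prob (E j) = Q $$ (i, j) * \<P>(\<omega> in \<Omega>. x (t - 1) \<omega> = j \<and> H (\<lambda>r. x r \<omega>))"
      unfolding E_def using Cons.prems that
    \<comment> \<open>For nonempty \<open>us\<close> the oldest observation is at time
      \<open>t - 1 - length us\<close>, exactly the start of this window.\<close>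
    proof (rule chain_step[where m = "length us"])
      fix z z' :: "int \<Rightarrow> nat"
      assume eq: "\<And>r. r \<in> {t - 1 - int (length us)..t - 1} \<Longrightarrow> z r = z' r"
      have "z (t - 1 - 1 - int l) = z' (t - 1 - 1 - int l)" if "l < length us" for l
        using that by (intro eq) auto
      then show "H z = H z'" by (simp add: H_def)
    qed
    also have "\<P>(\<omega> in \<Omega>. x (t - 1) \<omega> = j \<and> H (\<lambda>r. x r \<omega>)) = b $ j"
      using Cons.IH[OF that, of "t - 1"] by (simp only: H_def b_def)
    finally show ?thesis .
  qed
  have "{\<omega> \<in> space \<Omega>. x t \<omega> = i \<and> (\<forall>l<length (u # us). \<phi> (x (t - 1 - int l) \<omega>) = (u # us) ! l)} =
      (\<Union>j\<in>{j. j < k \<and> \<phi> j = u}. E j)"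
  proof (rule Set.set_eqI)
    fix \<omega>
    have "(\<forall>l<length (u # us). \<phi> (x (t - 1 - int l) \<omega>) = (u # us) ! l) \<longleftrightarrow>
        \<phi> (x (t - 1) \<omega>) = u \<and> H (\<lambda>r. x r \<omega>)"
      unfolding H_def length_Cons All_less_Suc2 by (simp add: algebra_simps)
    then show "\<omega> \<in> {\<omega> \<in> space \<Omega>. x t \<omega> = i \<and> (\<forall>l<length (u # us). \<phi> (x (t - 1 - int l) \<omega>) = (u # us) ! l)} \<longleftrightarrow>
        \<omega> \<in> (\<Union>j\<in>{j. j < k \<and> \<phi> j = u}. E j)"
      using chain_state_less[of \<omega> "t - 1"] unfolding E_def by auto
  qed
  then have "\<P>(\<omega> in \<Omega>. x t \<omega> = i \<and> (\<forall>l<length (u # us). \<phi> (x (t - 1 - int l) \<omega>) = (u # us) ! l)) =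
      prob (\<Union>j\<in>{j. j < k \<and> \<phi> j = u}. E j)" by (rule arg_cong)
  also have "\<dots> = (\<Sum>j\<in>{j. j < k \<and> \<phi> j = u}. prob (E j))"
    using E_ev by (intro finite_measure_finite_Union) (auto simp: disjoint_family_on_def E_def)
  also have "\<dots> = (\<Sum>j\<in>{j. j < k \<and> \<phi> j = u}. Q $$ (i, j) * b $ j)"
    using E_prob by (intro sum.cong) auto
  \<comment> \<open>The excluded states return with value zero, which is the effect of
    \<open>I\<^sub>u\<close>.\<close>
  also have "\<dots> = (\<Sum>j<k. Q $$ (i, j) * (if \<phi> j = u then b $ j else 0))"
    by (intro sum.mono_neutral_cong_left) auto
  also have "\<dots> = (Q *\<^sub>v (symbol_proj k \<phi> u *\<^sub>v b)) $ i"
    using chain_carrier Cons.prems unfolding symbol_proj_mult_vec[OF b]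
    by (simp add: scalar_prod_def atLeast0LessThan)
  finally show ?case by (simp only: backward_vec.simps b_def)
qed

text \<open>The state at time \<open>t\<close>, one unit after the latest observation, is summed
  out.\<close>

lemma chain_observation_prob:
  "\<P>(\<omega> in \<Omega>. \<forall>l<length us. \<phi> (x (t - 1 - int l) \<omega>) = us ! l) =
    ones k \<bullet> backward_vec k \<phi> Q (state_distribution \<Omega> k x) us"
proof -
  interpret prob_space \<Omega> by (rule chain_prob_space)
  let ?E = "\<lambda>i. {\<omega> \<in> space \<Omega>. x t \<omega> = i \<and> (\<forall>l<length us. \<phi> (x (t - 1 - int l) \<omega>) = us ! l)}"
  have E_ev: "?E i \<in> events" for i
    by (intro sets.sets_Collect_conj chain_state_event chain_observation_event)
  have b: "backward_vec k \<phi> Q (state_distribution \<Omega> k x) us \<in> carrier_vec k"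
    using chain_carrier by (rule backward_vec_carrier) (simp add: state_distribution_def)
  have "{\<omega> \<in> space \<Omega>. \<forall>l<length us. \<phi> (x (t - 1 - int l) \<omega>) = us ! l} = (\<Union>i<k. ?E i)"
    using chain_state_less by auto
  then have "\<P>(\<omega> in \<Omega>. \<forall>l<length us. \<phi> (x (t - 1 - int l) \<omega>) = us ! l) = prob (\<Union>i<k. ?E i)"
    by (rule arg_cong)
  also have "\<dots> = (\<Sum>i<k. prob (?E i))"
    using E_ev by (intro finite_measure_finite_Union) (auto simp: disjoint_family_on_def)
  also have "\<dots> = ones k \<bullet> backward_vec k \<phi> Q (state_distribution \<Omega> k x) us"
    unfolding ones_scalar_prod[OF b] by (intro sum.cong refl chain_backward_vec) simp
  finally show ?thesis .
qed

end

section \<open>Window probabilities of a realization\<close>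

lemma window_nth_rev_append:
  assumes "length f = n" "length p = n" "l < 2 * n + 1"
  shows "window f p c (int n - int l) = (rev f @ c # p) ! l"
proof -
  consider "l < n" | "l = n" | "l > n" by linarith
  then show ?thesis
  proof cases
    case 1
    then have "nat (int n - int l - 1) = n - Suc l" by simp
    then show ?thesis using 1 assms by (simp add: window_def nth_append rev_nth)
  next
    case 2
    then show ?thesis using assms by (simp add: window_def nth_append)
  next
    case 3
    then obtain q where "l = Suc (n + q)" using less_imp_Suc_add by blast
    then show ?thesis using assms by (simp add: window_def nth_append)
  qed
qed

text \<open>Equality of laws moves the event to the hidden chain. Seen from time
  \<open>n + 1\<close> the whole window is past, so one backward vector gives its probability;
  regrouping it around the present leaves a leading \<open>Q\<close>, which the ones vector
  absorbs.\<close>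

lemma law_tensor_realization:
  assumes real: "hmm_realization \<Omega> y \<Omega>' x d k \<phi> Ob Q"
    and f: "f \<in> words d n" and p: "p \<in> words d n" and c: "c < d"
  shows "law_tensor \<Omega> y d n (word_index d f, word_index d p, c) =
    ones k \<bullet> (word_prod k \<phi> Q f *\<^sub>v (symbol_proj k \<phi> c *\<^sub>v
      backward_vec k \<phi> Q (state_distribution \<Omega>' k x) p))"
proof -
  let ?R = "{- int n..int n}" and ?w = "window f p c" and ?\<rho> = "state_distribution \<Omega>' k x"
  have y: "y t \<in> measurable \<Omega> (count_space {..<d})" for t
    using real by (simp add: hmm_realization_def stationary_process_def)
  have chain: "stationary_markov_chain \<Omega>' k x Q" and \<phi>: "\<phi> \<in> {..<k} \<rightarrow> {..<d}"
    and law: "process_law \<Omega> d y = process_law \<Omega>' d (\<lambda>t \<omega>. \<phi> (x t \<omega>))"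
    using real by (auto simp: hmm_realization_def)
  have \<phi>x: "(\<lambda>\<omega>. \<phi> (x t \<omega>)) \<in> measurable \<Omega>' (count_space {..<d})" for t
    by (rule measurable_compose[OF chain_measurable[OF chain]]) (use \<phi> in simp)
  have lt: "word_index d f < d ^ n" "word_index d p < d ^ n"
    using f p word_index_less[of f d] word_index_less[of p d] by (auto simp: words_def)
  have len: "length f = n" "length p = n" using f p by (auto simp: words_def)
  note Q = chain_carrier[OF chain]
  have \<rho>: "?\<rho> \<in> carrier_vec k" by (simp add: state_distribution_def)
  have b: "backward_vec k \<phi> Q ?\<rho> p \<in> carrier_vec k" using Q \<rho> by (rule backward_vec_carrier)
  have z: "word_prod k \<phi> Q f *\<^sub>v (symbol_proj k \<phi> c *\<^sub>v backward_vec k \<phi> Q ?\<rho> p) \<in> carrier_vec k"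
    by (rule mult_mat_vec_carrier[OF word_prod_carrier[OF Q] mult_mat_vec_carrier[OF symbol_proj_carrier b]])
  have "law_tensor \<Omega> y d n (word_index d f, word_index d p, c) = \<P>(\<omega> in \<Omega>. \<forall>t\<in>?R. y t \<omega> = ?w t)"
    using lt c f p by (simp add: law_tensor_def word_of_index_word_index)
  also have "\<dots> = \<P>(\<omega> in \<Omega>'. \<forall>t\<in>?R. \<phi> (x t \<omega>) = ?w t)"
    using measure_process_law[of y \<Omega> d ?R ?w, OF y]
      measure_process_law[of "\<lambda>t \<omega>. \<phi> (x t \<omega>)" \<Omega>' d ?R ?w, OF \<phi>x]
    by (simp only: law finite_atLeastAtMost_int)
  also have "\<dots> = \<P>(\<omega> in \<Omega>'. \<forall>l<length (rev f @ c # p).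
      \<phi> (x (int n + 1 - 1 - int l) \<omega>) = (rev f @ c # p) ! l)"
  proof -
    have R: "?R = (\<lambda>l. int n - int l) ` {..<2 * n + 1}"
    proof (intro equalityI subsetI)
      fix t assume "t \<in> ?R"
      then show "t \<in> (\<lambda>l. int n - int l) ` {..<2 * n + 1}"
        by (intro image_eqI[of _ _ "nat (int n - t)"]) auto
    qed auto
    have "(\<forall>t\<in>?R. \<phi> (x t \<omega>) = ?w t) \<longleftrightarrow>
        (\<forall>l<length (rev f @ c # p). \<phi> (x (int n + 1 - 1 - int l) \<omega>) = (rev f @ c # p) ! l)" for \<omega>
      unfolding R using len window_nth_rev_append[OF len] by (auto simp del: nth_append)
    then show ?thesis by simp
  qed
  also have "\<dots> = ones k \<bullet> backward_vec k \<phi> Q ?\<rho> (rev f @ c # p)"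
    using chain by (rule chain_observation_prob)
  also have "\<dots> = ones k \<bullet> (word_prod k \<phi> Q f *\<^sub>v (symbol_proj k \<phi> c *\<^sub>v backward_vec k \<phi> Q ?\<rho> p))"
    unfolding backward_vec_rev_append[OF Q \<rho>]
    using Q z chain_column_sum[OF chain] by (rule ones_scalar_prod_stochastic)
  finally show ?thesis .
qed

section \<open>Reduction to the reachable subspace\<close>

text \<open>Inside the box every index is the number of a word; outside, extensionality fixes both
  values.\<close>

lemma tensor_box_eqI:
  assumes "F \<in> extensional ({..<d ^ n} \<times> {..<d ^ n} \<times> {..<d})"
    and "G \<in> extensional ({..<d ^ n} \<times> {..<d ^ n} \<times> {..<d})"
    and eq: "\<And>f p c. f \<in> words d n \<Longrightarrow> p \<in> words d n \<Longrightarrow> c < d \<Longrightarrow>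
      F (word_index d f, word_index d p, c) = G (word_index d f, word_index d p, c)"
  shows "F = G"
proof (rule extensionalityI[OF assms(1,2)])
  fix abc assume "abc \<in> {..<d ^ n} \<times> {..<d ^ n} \<times> {..<d}"
  then obtain a b c where "abc = (a, b, c)" "a \<in> {..<d ^ n}" "b \<in> {..<d ^ n}" "c < d" by auto
  then show "F abc = G abc"
    using eq unfolding bij_betw_imp_surj_on[OF bij_betw_word_index, of d n, symmetric] by auto
qed

lemma cp_tensor_extensional:
  "cp_tensor X Y Z \<in> extensional ({..<dim_row X} \<times> {..<dim_row Y} \<times> {..<dim_row Z})"
  by (simp add: cp_tensor_def)

text \<open>A nonzero entry \<open>T $$ (i, j)\<close> forces \<open>\<phi> i = \<phi>h j\<close>,
  so the whole column sum 1 of column \<open>j\<close> falls into row \<open>\<phi>h j\<close> of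
  the product. The reduced observation matrix thus has the form that
  \<open>cp_tensor_word_matrix\<close> treats.\<close>

lemma obs_mat_mult_block:
  fixes T :: "real mat"
  assumes T: "T \<in> carrier_mat k r" and \<phi>h: "\<phi>h \<in> {..<r} \<rightarrow> {..<d}"
    and block: "\<And>i j. i < k \<Longrightarrow> j < r \<Longrightarrow> \<phi> i \<noteq> \<phi>h j \<Longrightarrow> T $$ (i, j) = 0"
    and sums: "mat_of_row (ones k) * T = mat_of_row (ones r)"
  shows "obs_mat d k \<phi> * T = obs_mat d r \<phi>h"
proof (rule eq_matI)
  fix u j assume "u < dim_row (obs_mat d r \<phi>h)" "j < dim_col (obs_mat d r \<phi>h)"
  then have u: "u < d" and j: "j < r" by simp_all
  have col: "(\<Sum>i<k. T $$ (i, j)) = 1"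
  proof -
    have "(mat_of_row (ones k) * T) $$ (0, j) = (\<Sum>i<k. T $$ (i, j))"
      using T j by (simp add: scalar_prod_def atLeast0LessThan ones_def)
    moreover have "(mat_of_row (ones r) :: real mat) $$ (0, j) = 1"
      using j by (simp add: ones_def)
    ultimately show ?thesis using sums by simp
  qed
  have "(obs_mat d k \<phi> * T) $$ (u, j) = (\<Sum>i<k. obs_mat d k \<phi> $$ (u, i) * T $$ (i, j))"
    using u j T by (simp add: scalar_prod_def atLeast0LessThan)
  also have "\<dots> = (\<Sum>i<k. if \<phi>h j = u then T $$ (i, j) else 0)"
    using u j block by (intro sum.cong) auto
  also have "\<dots> = obs_mat d r \<phi>h $$ (u, j)"
    using u j col by simp
  finally show "(obs_mat d k \<phi> * T) $$ (u, j) = obs_mat d r \<phi>h $$ (u, j)" .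
qed (use T in simp_all)

theorem theorem6:
  fixes \<Omega> :: "'a measure" and y :: "int \<Rightarrow> 'a \<Rightarrow> nat"
    and \<Omega>' :: "'b measure" and x :: "int \<Rightarrow> 'b \<Rightarrow> nat"
    and d k n r :: nat
    and \<phi> \<phi>h :: "nat \<Rightarrow> nat"
    and Ob Q A B C T Qh Oh Ah Bh Ch :: "real mat"
    and \<rho> \<rho>h :: "real vec"
    and VR :: "real vec set"
  assumes n: "n \<ge> 1"
    and realization: "hmm_realization \<Omega> y \<Omega>' x d k \<phi> Ob Q"
    and rho: "\<rho> = state_distribution \<Omega>' k x"
    and A: "A = word_matrix d n k \<phi> Q (ones k)"
    and B: "B = word_matrix d n k \<phi> (transpose_mat Q) \<rho>"
    and C: "C = Ob"
    and VR: "VR = reachable_subspace d k \<phi> Q \<rho>"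
    and VRu: "\<forall>u<d. \<not> (\<lambda>v. symbol_proj k \<phi> u *\<^sub>v v) ` VR \<subseteq> mat_kernel (mat_of_row (ones k))"
    and r: "r = subspace_dim k VR" and r_less: "r < k"
    and T: "T \<in> carrier_mat k r" "vec_space.rank k T = r"
    and phih: "\<phi>h \<in> {..<r} \<rightarrow> {..<d}"
    and T_i: "\<forall>i<k. \<forall>j<r. \<phi> i \<noteq> \<phi>h j \<longrightarrow> T $$ (i, j) = 0"
    and T_ii: "VR = vec_space.col_space k T"
    and T_iii: "mat_of_row (ones k) * T = mat_of_row (ones r)"
    and Qh: "Qh = (THE X. X \<in> carrier_mat r r \<and> Q * T = T * X)"
    and Oh: "Oh = Ob * T"
    and rhoh: "\<rho>h = (THE v. v \<in> carrier_vec r \<and> \<rho> = T *\<^sub>v v)"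
    and Ah: "Ah = word_matrix d n r \<phi>h Qh (ones r)"
    and Bh: "Bh = word_matrix d n r \<phi>h (transpose_mat Qh) \<rho>h"
    and Ch: "Ch = Oh"
  shows "law_tensor \<Omega> y d n = cp_tensor A B C \<and> cp_tensor A B C = cp_tensor Ah Bh Ch"
proof -
  have chain: "stationary_markov_chain \<Omega>' k x Q" and \<phi>: "\<phi> \<in> {..<k} \<rightarrow> {..<d}"
    and Ob: "Ob = obs_mat d k \<phi>"
    using realization by (auto simp: hmm_realization_def)
  note Q = chain_carrier[OF chain]
  have \<rho>: "\<rho> \<in> carrier_vec k" by (simp add: rho state_distribution_def)
  have block: "T $$ (i, j) = 0" if "i < k" "j < r" "\<phi> i \<noteq> \<phi>h j" for i j
    using T_i that by blast
  have range: "\<exists>v\<in>carrier_vec r. w = T *\<^sub>v v" if "w \<in> VR" for w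
    using that T(1) unfolding T_ii vec_space.col_space_eq[OF T(1)] by auto
  have T_unit: "T *\<^sub>v unit_vec r j = col T j" if "j < r" for j
    using T(1) that by (intro eq_vecI) (simp_all add: scalar_prod_right_unit)
  have col_VR: "col T j \<in> VR" if "j < r" for j
    using T(1) that T_unit[OF that] unfolding T_ii vec_space.col_space_eq[OF T(1)]
    by (auto intro!: bexI[of _ "unit_vec r j"])
  \<comment> \<open>The description of \<open>\<rho>h\<close> is proper: coordinates exist because
    \<open>\<rho>\<close> lies in \<open>VR\<close>, and full column rank makes them unique.\<close>
  have "\<rho>h \<in> carrier_vec r \<and> \<rho> = T *\<^sub>v \<rho>h"
    unfolding rhoh
  proof (rule theI')
    have "\<rho> \<in> VR" unfolding VR using Q \<rho> \<phi> by (rule mem_reachable_subspace)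
    then show "\<exists>!v. v \<in> carrier_vec r \<and> \<rho> = T *\<^sub>v v"
      using range mult_mat_vec_inj_of_full_rank[OF T] by metis
  qed
  then have \<rho>h: "\<rho>h \<in> carrier_vec r" and T\<rho>h: "\<rho> = T *\<^sub>v \<rho>h" by simp_all
  have "Qh \<in> carrier_mat r r \<and> Q * T = T * Qh"
    unfolding Qh
  proof (rule theI')
    \<comment> \<open>The columns of \<open>T\<close> lie in \<open>VR\<close>, which
      \<open>Q\<close> preserves; the coordinates of their images become the columns of
      \<open>X\<close>.\<close>
    have "\<exists>v\<in>carrier_vec r. Q *\<^sub>v col T j = T *\<^sub>v v" if "j < r" for j
      using range reachable_subspace_invariant[OF Q \<rho> \<phi>] col_VR[OF that] unfolding VR by blast
    then obtain g where g: "\<And>j. j < r \<Longrightarrow> g j \<in> carrier_vec r"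
      and Tg: "\<And>j. j < r \<Longrightarrow> Q *\<^sub>v col T j = T *\<^sub>v g j"
      by metis
    define X where "X = mat r r (\<lambda>(i, j). g j $ i)"
    have X: "X \<in> carrier_mat r r" by (simp add: X_def)
    have colX: "col X j = g j" if "j < r" for j
      using g[OF that] that by (intro eq_vecI) (simp_all add: X_def)
    have QTX: "Q * T = T * X"
    proof (rule mat_col_eqI)
      fix j assume "j < dim_col (T * X)"
      then have j: "j < r" using X by simp
      then show "col (Q * T) j = col (T * X) j"
        by (simp only: Tg[OF j] colX[OF j] col_mult2[OF Q T(1) j] col_mult2[OF T(1) X j])
    qed (use Q T(1) X in simp_all)
    \<comment> \<open>Injectivity of \<open>T\<close> gives uniqueness column by column.\<close>
    have "X' = X" if X': "X' \<in> carrier_mat r r" "Q * T = T * X'" for X'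
    proof (rule mat_col_eqI)
      fix j assume "j < dim_col X"
      then have j: "j < r" using X by simp
      have colc: "col X' j \<in> carrier_vec r" "col X j \<in> carrier_vec r"
        using X X'(1) j by simp_all
      have "T *\<^sub>v col X' j = T *\<^sub>v col X j"
        by (simp only: col_mult2[OF T(1) X j, symmetric] col_mult2[OF T(1) X'(1) j, symmetric]
            QTX[symmetric] X'(2)[symmetric])
      then show "col X' j = col X j"
        by (rule mult_mat_vec_inj_of_full_rank[OF T colc])
    qed (use X X'(1) in simp_all)
    then show "\<exists>!X. X \<in> carrier_mat r r \<and> Q * T = T * X"
      using X QTX by (intro ex1I[of _ X]) auto
  qed
  then have Qhc: "Qh \<in> carrier_mat r r" and QT: "Q * T = T * Qh" by simp_all
  have Ch_obs: "Ch = obs_mat d r \<phi>h"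
    unfolding Ch Oh Ob using T(1) phih block T_iii by (rule obs_mat_mult_block)
  \<comment> \<open>Both decompositions are compared with this expression in the given
    model.\<close>
  let ?entry = "\<lambda>f p c. ones k \<bullet> (word_prod k \<phi> Q f *\<^sub>v (symbol_proj k \<phi> c *\<^sub>v backward_vec k \<phi> Q \<rho> p))"
  have ones: "ones m \<in> carrier_vec m" for m by (simp add: ones_def)
  have cp: "cp_tensor A B C (word_index d f, word_index d p, c) = ?entry f p c"
    if "f \<in> words d n" "p \<in> words d n" "c < d" for f p c
    unfolding A B C Ob using Q ones \<rho> that by (rule cp_tensor_word_matrix)
  have cph: "cp_tensor Ah Bh Ch (word_index d f, word_index d p, c) = ?entry f p c"
    if fpc: "f \<in> words d n" "p \<in> words d n" "c < d" for f p c
  proof -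
    let ?b = "backward_vec r \<phi>h Qh \<rho>h p"
    let ?z = "symbol_proj r \<phi>h c *\<^sub>v ?b"
    have b: "?b \<in> carrier_vec r" using Qhc \<rho>h by (rule backward_vec_carrier)
    have z: "?z \<in> carrier_vec r" by (rule mult_mat_vec_carrier[OF symbol_proj_carrier b])
    have Wz: "word_prod r \<phi>h Qh f *\<^sub>v ?z \<in> carrier_vec r"
      by (rule mult_mat_vec_carrier[OF word_prod_carrier[OF Qhc] z])
    note data = Q Qhc T(1) QT block
    \<comment> \<open>Starting from \<open>\<rho> = T \<rho>h\<close>, the matrix \<open>T\<close>
      moves left past the factors of the past, the present and the future in turn; then
      \<open>e\<^sup>T T\<close> becomes the reduced ones vector by \<open>T_iii\<close>.\<close>
    have "word_prod k \<phi> Q f *\<^sub>v (symbol_proj k \<phi> c *\<^sub>v backward_vec k \<phi> Q \<rho> p) =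
        T *\<^sub>v (word_prod r \<phi>h Qh f *\<^sub>v ?z)"
      unfolding T\<rho>h
      by (simp only: intertwine_backward_vec[OF data \<rho>h] intertwine_symbol_proj[OF data b]
          intertwine_word_prod[OF data z])
    then have "?entry f p c = ones k \<bullet> (T *\<^sub>v (word_prod r \<phi>h Qh f *\<^sub>v ?z))" by (simp only:)
    also have "\<dots> = (mat_of_row (ones k) *\<^sub>v (T *\<^sub>v (word_prod r \<phi>h Qh f *\<^sub>v ?z))) $ 0"
      by simp
    also have "\<dots> = (mat_of_row (ones r) *\<^sub>v (word_prod r \<phi>h Qh f *\<^sub>v ?z)) $ 0"
      by (simp only: assoc_mult_mat_vec[OF mat_of_row_carrier(1)[OF ones] T(1) Wz, symmetric] T_iii)
    also have "\<dots> = ones r \<bullet> (word_prod r \<phi>h Qh f *\<^sub>v ?z)"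
      by simp
    finally show ?thesis
      unfolding Ah Bh Ch_obs using cp_tensor_word_matrix[OF Qhc ones \<rho>h fpc] by simp
  qed
  have "law_tensor \<Omega> y d n = cp_tensor A B C"
  proof (rule tensor_box_eqI)
    show "law_tensor \<Omega> y d n \<in> extensional ({..<d ^ n} \<times> {..<d ^ n} \<times> {..<d})"
      by (simp add: law_tensor_def)
    show "cp_tensor A B C \<in> extensional ({..<d ^ n} \<times> {..<d ^ n} \<times> {..<d})"
      using cp_tensor_extensional[of A B C] by (simp add: A B C Ob)
  qed (simp add: cp law_tensor_realization[OF realization] rho)
  moreover have "cp_tensor A B C = cp_tensor Ah Bh Ch"
  proof (rule tensor_box_eqI)
    show "cp_tensor A B C \<in> extensional ({..<d ^ n} \<times> {..<d ^ n} \<times> {..<d})"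
      using cp_tensor_extensional[of A B C] by (simp add: A B C Ob)
    show "cp_tensor Ah Bh Ch \<in> extensional ({..<d ^ n} \<times> {..<d ^ n} \<times> {..<d})"
      using cp_tensor_extensional[of Ah Bh Ch] by (simp add: Ah Bh Ch_obs)
  qed (simp add: cp cph)
  ultimately show ?thesis by blast
qed

end
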